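(* (i) All axioms of $\mathsf{TFS}$ (namely Ext, Class, Set and Ind) hold when relativized to the class $\mathbb{S}$ of standard sets. (ii) The universe $\mathbb{H}$ of all sets and the universe $\mathbb{S}$ of standard sets both satisfy all axioms of $\mathsf{ZF}^{\mathrm{fin}}$.
   Context: The theory is formulated in a first-order language whose only non-logical symbol is the binary predicate $\in$; its objects are called classes. A class is a set iff it is a member of some class; $\mathbb{H}$ is the class of all sets. A set formula is a formula whose quantifiers range only over sets and which contains no class variables or constants. $\mathsf{TFS}$ consists of: (Ext) two classes with the same set-elements are equal; (Class) for every formula $\Phi$ (arbitrary, possibly quantifying over classes) and classes $X_1,\dots,X_n$ there is a class $Y$ with $y\in Y\leftrightarrow\Phi(y,X_1,\dots,X_n)$ for all sets $y$; (Set) $\emptyset$ is a set, and $x\cup\{y\}$ is a set for all sets $x,y$; (Ind) for every set formula $\varphi$: if $\varphi(\emptyset)$ and $\forall x\forall y(\varphi(x)\wedge\varphi(y)\to\varphi(x\cup\{y\}))$, then $\forall x\,\varphi(x)$. The class $\mathbb{S}$ of standard sets is the smallest class containing $\emptyset$ and closed under $(a,b)\mapsto a\cup\{b\}$, i.e. $\mathbb{S}=\{x:\forall S([\emptyset\in S\wedge\forall a,b\in S\,(a\cup\{b\}\in S)]\to x\in S)\}$. $\mathsf{ZF}^{\mathrm{fin}}$ is $\mathsf{ZF}$ with the axiom of infinity replaced by its negation, plus the axiom that every set has a transitive closure. *)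

theory Defs
  imports Main
begin

text \<open>
  First-order formulas over a single binary predicate, with variables named by natural numbers.
\<close>

datatype fm =
    Mem nat nat  (infix "\<^bold>\<in>" 80)
  | Eq nat nat  (infix "\<^bold>=" 80)
  | Neg fm  ("\<^bold>\<not> _" [75] 75)
  | And fm fm  (infixr "\<^bold>\<and>" 70)
  | Or fm fm  (infixr "\<^bold>\<or>" 65)
  | Imp fm fm  (infixr "\<^bold>\<longrightarrow>" 60)
  | Iff fm fm  (infixr "\<^bold>\<longleftrightarrow>" 58)
  | All nat fm  ("(3\<^bold>\<forall>_./ _)" [0, 55] 55)
  | Ex nat fm  ("(3\<^bold>\<exists>_./ _)" [0, 55] 55)

primrec fv :: "fm \<Rightarrow> nat set" where
  "fv (x \<^bold>\<in> y) = {x, y}"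
| "fv (x \<^bold>= y) = {x, y}"
| "fv (\<^bold>\<not> \<phi>) = fv \<phi>"
| "fv (\<phi> \<^bold>\<and> \<psi>) = fv \<phi> \<union> fv \<psi>"
| "fv (\<phi> \<^bold>\<or> \<psi>) = fv \<phi> \<union> fv \<psi>"
| "fv (\<phi> \<^bold>\<longrightarrow> \<psi>) = fv \<phi> \<union> fv \<psi>"
| "fv (\<phi> \<^bold>\<longleftrightarrow> \<psi>) = fv \<phi> \<union> fv \<psi>"
| "fv (\<^bold>\<forall>x. \<phi>) = fv \<phi> - {x}"
| "fv (\<^bold>\<exists>x. \<phi>) = fv \<phi> - {x}"

primrec sat :: "'a set \<Rightarrow> ('a \<Rightarrow> 'a \<Rightarrow> bool) \<Rightarrow> (nat \<Rightarrow> 'a) \<Rightarrow> fm \<Rightarrow> bool" where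
  "sat M E e (x \<^bold>\<in> y) \<longleftrightarrow> E (e x) (e y)"
| "sat M E e (x \<^bold>= y) \<longleftrightarrow> e x = e y"
| "sat M E e (\<^bold>\<not> \<phi>) \<longleftrightarrow> \<not> sat M E e \<phi>"
| "sat M E e (\<phi> \<^bold>\<and> \<psi>) \<longleftrightarrow> sat M E e \<phi> \<and> sat M E e \<psi>"
| "sat M E e (\<phi> \<^bold>\<or> \<psi>) \<longleftrightarrow> sat M E e \<phi> \<or> sat M E e \<psi>"
| "sat M E e (\<phi> \<^bold>\<longrightarrow> \<psi>) \<longleftrightarrow> (sat M E e \<phi> \<longrightarrow> sat M E e \<psi>)"
| "sat M E e (\<phi> \<^bold>\<longleftrightarrow> \<psi>) \<longleftrightarrow> (sat M E e \<phi> \<longleftrightarrow> sat M E e \<psi>)"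
| "sat M E e (\<^bold>\<forall>x. \<phi>) \<longleftrightarrow> (\<forall>a\<in>M. sat M E (e(x := a)) \<phi>)"
| "sat M E e (\<^bold>\<exists>x. \<phi>) \<longleftrightarrow> (\<exists>a\<in>M. sat M E (e(x := a)) \<phi>)"

definition models :: "'a set \<Rightarrow> ('a \<Rightarrow> 'a \<Rightarrow> bool) \<Rightarrow> fm set \<Rightarrow> bool" where
  "models M E T \<longleftrightarrow> M \<noteq> {} \<and> (\<forall>\<phi>\<in>T. \<forall>e. range e \<subseteq> M \<longrightarrow> sat M E e \<phi>)"

definition closure :: "fm \<Rightarrow> fm" where
  "closure \<phi> = foldr All (sorted_list_of_set (fv \<phi>)) \<phi>"

text \<open>
  Relativization of all quantifiers to the class defined by \<open>\<delta>\<close>, where \<open>\<delta> x\<close> is a formula whose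
  only free variable is \<open>x\<close>.
\<close>

primrec rel :: "(nat \<Rightarrow> fm) \<Rightarrow> fm \<Rightarrow> fm" where
  "rel \<delta> (x \<^bold>\<in> y) = x \<^bold>\<in> y"
| "rel \<delta> (x \<^bold>= y) = x \<^bold>= y"
| "rel \<delta> (\<^bold>\<not> \<phi>) = \<^bold>\<not> rel \<delta> \<phi>"
| "rel \<delta> (\<phi> \<^bold>\<and> \<psi>) = rel \<delta> \<phi> \<^bold>\<and> rel \<delta> \<psi>"
| "rel \<delta> (\<phi> \<^bold>\<or> \<psi>) = rel \<delta> \<phi> \<^bold>\<or> rel \<delta> \<psi>"
| "rel \<delta> (\<phi> \<^bold>\<longrightarrow> \<psi>) = rel \<delta> \<phi> \<^bold>\<longrightarrow> rel \<delta> \<psi>"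
| "rel \<delta> (\<phi> \<^bold>\<longleftrightarrow> \<psi>) = rel \<delta> \<phi> \<^bold>\<longleftrightarrow> rel \<delta> \<psi>"
| "rel \<delta> (\<^bold>\<forall>x. \<phi>) = (\<^bold>\<forall>x. \<delta> x \<^bold>\<longrightarrow> rel \<delta> \<phi>)"
| "rel \<delta> (\<^bold>\<exists>x. \<phi>) = (\<^bold>\<exists>x. \<delta> x \<^bold>\<and> rel \<delta> \<phi>)"

text \<open>
  In the following, bound variables are chosen larger than the arguments to avoid capture.
  \<open>inst \<phi> x y\<close> expresses \<open>\<phi>(y)\<close> for \<open>\<phi> = \<phi>(x)\<close>; it is only used with \<open>x \<noteq> y\<close>.
  \<open>is_adj z x y\<close> expresses \<open>z = x \<union> {y}\<close>.
\<close>

definition inst :: "fm \<Rightarrow> nat \<Rightarrow> nat \<Rightarrow> fm" where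
  "inst \<phi> x y = (\<^bold>\<forall>x. x \<^bold>= y \<^bold>\<longrightarrow> \<phi>)"

definition is_set :: "nat \<Rightarrow> fm" where
  "is_set x = (\<^bold>\<exists>Suc x. x \<^bold>\<in> Suc x)"

definition is_empty :: "nat \<Rightarrow> fm" where
  "is_empty x = (\<^bold>\<forall>Suc x. \<^bold>\<not> Suc x \<^bold>\<in> x)"

definition is_adj :: "nat \<Rightarrow> nat \<Rightarrow> nat \<Rightarrow> fm" where
  "is_adj z x y = (let u = Suc (max z (max x y)) in
     \<^bold>\<forall>u. u \<^bold>\<in> z \<^bold>\<longleftrightarrow> u \<^bold>\<in> x \<^bold>\<or> u \<^bold>= y)"

definition is_sub :: "nat \<Rightarrow> nat \<Rightarrow> fm" where
  "is_sub x y = (let u = Suc (max x y) in \<^bold>\<forall>u. u \<^bold>\<in> x \<^bold>\<longrightarrow> u \<^bold>\<in> y)"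

definition is_trans :: "nat \<Rightarrow> fm" where
  "is_trans x = (\<^bold>\<forall>Suc x. Suc x \<^bold>\<in> x \<^bold>\<longrightarrow> is_sub (Suc x) x)"


subsection \<open>The theory of finite sets\<close>

definition TFS_Ext :: fm where
  "TFS_Ext = (\<^bold>\<forall>0. \<^bold>\<forall>1. (\<^bold>\<forall>2. is_set 2 \<^bold>\<longrightarrow> (2 \<^bold>\<in> 0 \<^bold>\<longleftrightarrow> 2 \<^bold>\<in> 1)) \<^bold>\<longrightarrow> 0 \<^bold>= 1)"

definition TFS_Class :: "fm set" where
  "TFS_Class = {closure (\<^bold>\<exists>Y. \<^bold>\<forall>y. is_set y \<^bold>\<longrightarrow> (y \<^bold>\<in> Y \<^bold>\<longleftrightarrow> \<phi>)) | \<phi> y Y. y \<noteq> Y \<and> Y \<notin> fv \<phi>}"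

definition TFS_Set_empty :: fm where
  "TFS_Set_empty = (\<^bold>\<exists>0. is_empty 0 \<^bold>\<and> is_set 0)"

definition TFS_Set_adj :: fm where
  "TFS_Set_adj = (\<^bold>\<forall>0. \<^bold>\<forall>1. is_set 0 \<^bold>\<and> is_set 1 \<^bold>\<longrightarrow> (\<^bold>\<exists>2. is_adj 2 0 1 \<^bold>\<and> is_set 2))"

definition ind :: "nat \<Rightarrow> nat \<Rightarrow> nat \<Rightarrow> fm \<Rightarrow> fm" where
  "ind x y z \<phi> =
     ((\<^bold>\<forall>x. is_empty x \<^bold>\<longrightarrow> \<phi>) \<^bold>\<and>
      (\<^bold>\<forall>x. \<^bold>\<forall>y. \<phi> \<^bold>\<and> inst \<phi> x y \<^bold>\<longrightarrow> (\<^bold>\<forall>z. is_adj z x y \<^bold>\<longrightarrow> inst \<phi> x z))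
      \<^bold>\<longrightarrow> (\<^bold>\<forall>x. \<phi>))"

text \<open>
  The set formulas are the formulas \<open>rel is_set \<phi>\<close> with set variables as parameters.  All quantifiers
  of an instance of induction range over sets, including those binding the parameters, so
  relativizing the whole instance for \<open>\<phi>\<close> gives induction for the set formula \<open>rel is_set \<phi>\<close>.
\<close>

definition TFS_Ind :: "fm set" where
  "TFS_Ind = {rel is_set (closure (ind x y z \<phi>)) | \<phi> x y z.
     distinct [x, y, z] \<and> y \<notin> fv \<phi> \<and> z \<notin> fv \<phi>}"

definition TFS :: "fm set" where
  "TFS = {TFS_Ext} \<union> TFS_Class \<union> {TFS_Set_empty, TFS_Set_adj} \<union> TFS_Ind"


subsection \<open>Standard sets\<close>

definition is_std :: "nat \<Rightarrow> fm" where
  "is_std x = (let S = x + 1; a = x + 2; b = x + 3; c = x + 4 in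
     is_set x \<^bold>\<and>
     (\<^bold>\<forall>S. (\<^bold>\<exists>a. is_empty a \<^bold>\<and> a \<^bold>\<in> S) \<^bold>\<and>
          (\<^bold>\<forall>a. \<^bold>\<forall>b. a \<^bold>\<in> S \<^bold>\<and> b \<^bold>\<in> S \<^bold>\<longrightarrow> (\<^bold>\<exists>c. is_adj c a b \<^bold>\<and> c \<^bold>\<in> S))
          \<^bold>\<longrightarrow> x \<^bold>\<in> S))"

text \<open>
  The classes of the universe of standard sets are the subclasses of the class of standard sets.
  Relativizing a formula about classes to the standard sets therefore means letting its variables
  range over these subclasses; the objects among them that are members of such a subclass are
  the standard sets.
\<close>

definition is_std_class :: "nat \<Rightarrow> fm" where
  "is_std_class X = (\<^bold>\<forall>Suc X. Suc X \<^bold>\<in> X \<^bold>\<longrightarrow> is_std (Suc X))"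


subsection \<open>Finite Zermelo-Fraenkel set theory\<close>

definition ZF_Ext :: fm where
  "ZF_Ext = (\<^bold>\<forall>0. \<^bold>\<forall>1. (\<^bold>\<forall>2. 2 \<^bold>\<in> 0 \<^bold>\<longleftrightarrow> 2 \<^bold>\<in> 1) \<^bold>\<longrightarrow> 0 \<^bold>= 1)"

definition ZF_Empty :: fm where
  "ZF_Empty = (\<^bold>\<exists>0. is_empty 0)"

definition ZF_Pair :: fm where
  "ZF_Pair = (\<^bold>\<forall>0. \<^bold>\<forall>1. \<^bold>\<exists>2. \<^bold>\<forall>3. 3 \<^bold>\<in> 2 \<^bold>\<longleftrightarrow> 3 \<^bold>= 0 \<^bold>\<or> 3 \<^bold>= 1)"

definition ZF_Union :: fm where
  "ZF_Union = (\<^bold>\<forall>0. \<^bold>\<exists>1. \<^bold>\<forall>2. 2 \<^bold>\<in> 1 \<^bold>\<longleftrightarrow> (\<^bold>\<exists>3. 3 \<^bold>\<in> 0 \<^bold>\<and> 2 \<^bold>\<in> 3))"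

definition ZF_Power :: fm where
  "ZF_Power = (\<^bold>\<forall>0. \<^bold>\<exists>1. \<^bold>\<forall>2. 2 \<^bold>\<in> 1 \<^bold>\<longleftrightarrow> is_sub 2 0)"

definition ZF_Foundation :: fm where
  "ZF_Foundation =
     (\<^bold>\<forall>0. (\<^bold>\<exists>1. 1 \<^bold>\<in> 0) \<^bold>\<longrightarrow> (\<^bold>\<exists>1. 1 \<^bold>\<in> 0 \<^bold>\<and> \<^bold>\<not> (\<^bold>\<exists>2. 2 \<^bold>\<in> 0 \<^bold>\<and> 2 \<^bold>\<in> 1)))"

definition ZF_Separation :: "fm set" where
  "ZF_Separation = {closure (\<^bold>\<forall>a. \<^bold>\<exists>b. \<^bold>\<forall>x. x \<^bold>\<in> b \<^bold>\<longleftrightarrow> x \<^bold>\<in> a \<^bold>\<and> \<phi>) | \<phi> a b x.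
     distinct [a, b, x] \<and> b \<notin> fv \<phi>}"

definition ZF_Replacement :: "fm set" where
  "ZF_Replacement =
     {closure (\<^bold>\<forall>a. (\<^bold>\<forall>x. \<^bold>\<forall>y. \<^bold>\<forall>z. \<phi> \<^bold>\<and> inst \<phi> y z \<^bold>\<longrightarrow> y \<^bold>= z) \<^bold>\<longrightarrow>
                (\<^bold>\<exists>b. \<^bold>\<forall>y. y \<^bold>\<in> b \<^bold>\<longleftrightarrow> (\<^bold>\<exists>x. x \<^bold>\<in> a \<^bold>\<and> \<phi>))) | \<phi> a b x y z.
     distinct [a, b, x, y, z] \<and> b \<notin> fv \<phi> \<and> z \<notin> fv \<phi>}"

definition ZF_Infinity :: fm where
  "ZF_Infinity =
     (\<^bold>\<exists>0. (\<^bold>\<exists>1. is_empty 1 \<^bold>\<and> 1 \<^bold>\<in> 0) \<^bold>\<and>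
          (\<^bold>\<forall>1. 1 \<^bold>\<in> 0 \<^bold>\<longrightarrow> (\<^bold>\<exists>2. is_adj 2 1 1 \<^bold>\<and> 2 \<^bold>\<in> 0)))"

definition Trans_Closure :: fm where
  "Trans_Closure =
     (\<^bold>\<forall>0. \<^bold>\<exists>1. is_sub 0 1 \<^bold>\<and> is_trans 1 \<^bold>\<and>
          (\<^bold>\<forall>2. is_sub 0 2 \<^bold>\<and> is_trans 2 \<^bold>\<longrightarrow> is_sub 1 2))"

definition ZF_fin :: "fm set" where
  "ZF_fin = {ZF_Ext, ZF_Empty, ZF_Pair, ZF_Union, ZF_Power, ZF_Foundation}
     \<union> ZF_Separation \<union> ZF_Replacement \<union> {\<^bold>\<not> ZF_Infinity, Trans_Closure}"

end

theory Submission imports Defs begin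

text \<open>
  Call a structure a model of finite set theory if it satisfies extensionality, the existence of the
  empty set and of \<open>a \<union> {b}\<close>, and the induction scheme for all its first-order formulas.  In such a
  structure union, power set, separation, replacement and transitive closures are obtained by
  induction along \<open>a \<union> {b}\<close>; since the induction step may also assume the claim for \<open>b\<close>, the scheme
  yields \<open>\<in>\<close>-induction and hence foundation.  Infinity fails because every nonempty set has a
  \<open>\<subseteq>\<close>-maximal element \<open>m\<close>, and \<open>m \<union> {m} = m\<close> contradicts foundation.  The universe of all sets is
  such a structure by the axioms of \<open>TFS\<close>; the universe of standard sets is one because it is
  transitive, and for each formula the standard sets satisfying it form a class, so that the
  minimality of the class of standard sets gives induction.
\<close>

section \<open>Satisfaction\<close>

lemma finite_fv [simp]: "finite (fv \<phi>)"
  by (induction \<phi>) auto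

lemma fresh_variable:
  obtains v :: nat where "v \<notin> fv \<phi>" "v \<notin> set xs"
proof -
  have "\<exists>v. v \<notin> fv \<phi> \<union> set xs"
    by (rule ex_new_if_finite) auto
  then show thesis using that by auto
qed

lemma sat_cong:
  "(\<And>v. v \<in> fv \<phi> \<Longrightarrow> e v = f v) \<Longrightarrow> sat N E e \<phi> \<longleftrightarrow> sat N E f \<phi>"
proof (induction \<phi> arbitrary: e f)
  case (All x \<phi>)
  have "sat N E (e(x := a)) \<phi> \<longleftrightarrow> sat N E (f(x := a)) \<phi>" for a
    using All.prems by (intro All.IH) auto
  then show ?case by simp
next
  case (Ex x \<phi>)
  have "sat N E (e(x := a)) \<phi> \<longleftrightarrow> sat N E (f(x := a)) \<phi>" for a
    using Ex.prems by (intro Ex.IH) auto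
  then show ?case by simp
next
  case (And \<phi> \<psi>)
  have "sat N E e \<phi> \<longleftrightarrow> sat N E f \<phi>" by (rule And.IH(1)) (simp add: And.prems)
  moreover have "sat N E e \<psi> \<longleftrightarrow> sat N E f \<psi>" by (rule And.IH(2)) (simp add: And.prems)
  ultimately show ?case by simp
next
  case (Or \<phi> \<psi>)
  have "sat N E e \<phi> \<longleftrightarrow> sat N E f \<phi>" by (rule Or.IH(1)) (simp add: Or.prems)
  moreover have "sat N E e \<psi> \<longleftrightarrow> sat N E f \<psi>" by (rule Or.IH(2)) (simp add: Or.prems)
  ultimately show ?case by simp
next
  case (Imp \<phi> \<psi>)
  have "sat N E e \<phi> \<longleftrightarrow> sat N E f \<phi>" by (rule Imp.IH(1)) (simp add: Imp.prems)
  moreover have "sat N E e \<psi> \<longleftrightarrow> sat N E f \<psi>" by (rule Imp.IH(2)) (simp add: Imp.prems)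
  ultimately show ?case by simp
next
  case (Iff \<phi> \<psi>)
  have "sat N E e \<phi> \<longleftrightarrow> sat N E f \<phi>" by (rule Iff.IH(1)) (simp add: Iff.prems)
  moreover have "sat N E e \<psi> \<longleftrightarrow> sat N E f \<psi>" by (rule Iff.IH(2)) (simp add: Iff.prems)
  ultimately show ?case by simp
next
  case (Neg \<phi>)
  have "sat N E e \<phi> \<longleftrightarrow> sat N E f \<phi>" by (rule Neg.IH) (simp add: Neg.prems)
  then show ?case by simp
qed auto

text \<open>A block of universal quantifiers is read as one quantifier over environments, so the
  order fixed by \<open>sorted_list_of_set\<close> in \<open>closure\<close> becomes
  irrelevant.\<close>

lemma sat_foldr_All:
  "sat N E e (foldr All xs \<phi>) \<longleftrightarrow>
     (\<forall>f. (\<forall>x. if x \<in> set xs then f x \<in> N else f x = e x) \<longrightarrow> sat N E f \<phi>)"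
proof (induction xs arbitrary: e)
  case Nil
  have "f = e" if "\<forall>x. f x = e x" for f using that by auto
  then show ?case by auto
next
  case (Cons x xs)
  let ?Q = "\<lambda>e xs f. \<forall>y. if y \<in> set xs then f y \<in> N else f y = e y"
  have Q: "?Q e (x # xs) f \<longleftrightarrow> (\<exists>a\<in>N. ?Q (e(x := a)) xs f)" for f
  proof
    assume "\<exists>a\<in>N. ?Q (e(x := a)) xs f"
    then obtain a where a: "a \<in> N" "?Q (e(x := a)) xs f" ..
    have "if y \<in> set (x # xs) then f y \<in> N else f y = e y" for y
      using a(1) a(2)[rule_format, of y] by (auto split: if_splits)
    then show "?Q e (x # xs) f" ..
  next
    assume Q: "?Q e (x # xs) f"
    \<comment> \<open>The witness is \<open>f x\<close>. If \<open>x\<close> occurs again in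
      \<open>xs\<close>, the choice is overwritten later, so any element of \<open>N\<close> would
      do.\<close>
    have "f x \<in> N" using Q[rule_format, of x] by simp
    moreover have "if y \<in> set xs then f y \<in> N else f y = (e(x := f x)) y" for y
      using Q[rule_format, of y] by (auto split: if_splits)
    ultimately show "\<exists>a\<in>N. ?Q (e(x := a)) xs f" by blast
  qed
  have "sat N E e (foldr All (x # xs) \<phi>) \<longleftrightarrow> (\<forall>a\<in>N. \<forall>f. ?Q (e(x := a)) xs f \<longrightarrow> sat N E f \<phi>)"
    by (simp only: foldr.simps comp_apply sat.simps Cons.IH)
  moreover have "(\<forall>a\<in>N. \<forall>f. R a f \<longrightarrow> T f) \<longleftrightarrow> (\<forall>f. (\<exists>a\<in>N. R a f) \<longrightarrow> T f)"
    for R and T :: "(nat \<Rightarrow> 'a) \<Rightarrow> bool" by blast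
  ultimately show ?case by (simp only: Q)
qed

text \<open>Only the values on \<open>fv \<phi>\<close> matter, and these are exactly the variables
  that the closure quantifies. The environment on the left is arbitrary because the closure is a
  sentence.\<close>

lemma sat_closure:
  assumes "N \<noteq> {}"
  shows "sat N E e (closure \<phi>) \<longleftrightarrow> (\<forall>f. range f \<subseteq> N \<longrightarrow> sat N E f \<phi>)"
proof
  assume *: "sat N E e (closure \<phi>)"
  show "\<forall>f. range f \<subseteq> N \<longrightarrow> sat N E f \<phi>"
  proof (intro allI impI)
    fix f :: "nat \<Rightarrow> 'a" assume f: "range f \<subseteq> N"
    define g where "g = (\<lambda>v. if v \<in> fv \<phi> then f v else e v)"
    have "sat N E g \<phi>"
      using * f unfolding closure_def sat_foldr_All by (elim allE[of _ g]) (auto simp: g_def image_subset_iff)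
    then show "sat N E f \<phi>" by (subst sat_cong[of _ _ g]) (auto simp: g_def)
  qed
next
  assume *: "\<forall>f. range f \<subseteq> N \<longrightarrow> sat N E f \<phi>"
  obtain n where "n \<in> N" using assms by auto
  show "sat N E e (closure \<phi>)"
    unfolding closure_def sat_foldr_All
  proof (intro allI impI)
    fix f assume f: "\<forall>x. if x \<in> set (sorted_list_of_set (fv \<phi>)) then f x \<in> N else f x = e x"
    \<comment> \<open>Off \<open>fv \<phi>\<close> the values of \<open>f\<close> are those of
      \<open>e\<close> and may lie outside \<open>N\<close>; the default \<open>n\<close> moves them
      into \<open>N\<close> without affecting the truth of \<open>\<phi>\<close>.\<close>
    define g where "g = (\<lambda>v. if v \<in> fv \<phi> then f v else n)"
    have "range g \<subseteq> N" using f \<open>n \<in> N\<close> by (auto simp: g_def split: if_splits)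
    then have "sat N E g \<phi>" using * by blast
    then show "sat N E f \<phi>" by (subst sat_cong[of _ _ g]) (auto simp: g_def)
  qed
qed

text \<open>
  The environment may take values in a set \<open>R\<close> larger than the domain of quantification: the free
  variables of a relativized formula need not lie in the relativizing class.
\<close>

lemma sat_rel:
  assumes "\<And>x e. range e \<subseteq> R \<Longrightarrow> sat M E e (\<delta> x) \<longleftrightarrow> e x \<in> N" and "N \<subseteq> M" and "M \<subseteq> R"
  shows "range e \<subseteq> R \<Longrightarrow> sat M E e (rel \<delta> \<phi>) \<longleftrightarrow> sat N E e \<phi>"
proof (induction \<phi> arbitrary: e)
  case (All x \<phi>)
  have "range (e(x := a)) \<subseteq> R" if "a \<in> M" for a
    using All.prems that assms(3) by auto
  then have "sat M E (e(x := a)) (\<delta> x) \<longleftrightarrow> a \<in> N"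
    "sat M E (e(x := a)) (rel \<delta> \<phi>) \<longleftrightarrow> sat N E (e(x := a)) \<phi>" if "a \<in> M" for a
    using assms(1)[of "e(x := a)" x, unfolded fun_upd_same] All.IH[of "e(x := a)"] that
    by iprover+
  then show ?case using assms(2) by auto
next
  case (Ex x \<phi>)
  have "range (e(x := a)) \<subseteq> R" if "a \<in> M" for a
    using Ex.prems that assms(3) by auto
  then have "sat M E (e(x := a)) (\<delta> x) \<longleftrightarrow> a \<in> N"
    "sat M E (e(x := a)) (rel \<delta> \<phi>) \<longleftrightarrow> sat N E (e(x := a)) \<phi>" if "a \<in> M" for a
    using assms(1)[of "e(x := a)" x, unfolded fun_upd_same] Ex.IH[of "e(x := a)"] that
    by iprover+
  then show ?case using assms(2) by auto
qed auto

lemma range_upd: "range e \<subseteq> N \<Longrightarrow> a \<in> N \<Longrightarrow> range (e(x := a)) \<subseteq> N"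
  by auto

lemma const_range: "a \<in> N \<Longrightarrow> range (\<lambda>_. a) \<subseteq> N"
  by auto

section \<open>Truth conditions of the abbreviating formulas\<close>

lemma sat_is_set [simp]: "sat N E e (is_set x) \<longleftrightarrow> (\<exists>b\<in>N. E (e x) b)"
  by (simp add: is_set_def)

lemma sat_is_empty [simp]: "sat N E e (is_empty x) \<longleftrightarrow> (\<forall>u\<in>N. \<not> E u (e x))"
  by (simp add: is_empty_def)

lemma sat_is_adj [simp]:
  "sat N E e (is_adj z x y) \<longleftrightarrow> (\<forall>u\<in>N. E u (e z) \<longleftrightarrow> E u (e x) \<or> u = e y)"
proof -
  define v where "v = Suc (max z (max x y))"
  have "v \<noteq> z" "v \<noteq> x" "v \<noteq> y" unfolding v_def by linarith+
  then show ?thesis by (simp add: is_adj_def Let_def flip: v_def)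
qed

lemma sat_is_sub [simp]: "sat N E e (is_sub x y) \<longleftrightarrow> (\<forall>u\<in>N. E u (e x) \<longrightarrow> E u (e y))"
proof -
  define v where "v = Suc (max x y)"
  have "v \<noteq> x" "v \<noteq> y" unfolding v_def by linarith+
  then show ?thesis by (simp add: is_sub_def Let_def flip: v_def)
qed

lemma sat_is_trans [simp]:
  "sat N E e (is_trans x) \<longleftrightarrow> (\<forall>u\<in>N. E u (e x) \<longrightarrow> (\<forall>v\<in>N. E v u \<longrightarrow> E v (e x)))"
  by (simp add: is_trans_def)

text \<open>\<open>inst\<close> substitutes by a quantifier over \<open>N\<close>, so the value of
  \<open>y\<close> must lie in \<open>N\<close> for the substitution to take place.\<close>

lemma sat_inst: "x \<noteq> y \<Longrightarrow> e y \<in> N \<Longrightarrow> sat N E e (inst \<phi> x y) \<longleftrightarrow> sat N E (e(x := e y)) \<phi>"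
  by (auto simp: inst_def)

lemma sat_upd_fresh: "y \<notin> fv \<phi> \<Longrightarrow> sat N E (e(y := b)) \<phi> \<longleftrightarrow> sat N E e \<phi>"
  by (rule sat_cong) auto

lemma sat_upd_fresh2:
  "y \<notin> fv \<phi> \<Longrightarrow> sat N E (e(y := b, x := a)) \<phi> \<longleftrightarrow> sat N E (e(x := a)) \<phi>"
  by (rule sat_cong) auto

lemma sat_ind:
  assumes "distinct [x, y, z]" "y \<notin> fv \<phi>" "z \<notin> fv \<phi>"
  shows "sat N E e (ind x y z \<phi>) \<longleftrightarrow>
    ((\<forall>a\<in>N. (\<forall>u\<in>N. \<not> E u a) \<longrightarrow> sat N E (e(x := a)) \<phi>) \<and>
     (\<forall>a\<in>N. \<forall>b\<in>N. sat N E (e(x := a)) \<phi> \<and> sat N E (e(x := b)) \<phi> \<longrightarrow>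
       (\<forall>c\<in>N. (\<forall>u\<in>N. E u c \<longleftrightarrow> E u a \<or> u = b) \<longrightarrow> sat N E (e(x := c)) \<phi>))
     \<longrightarrow> (\<forall>a\<in>N. sat N E (e(x := a)) \<phi>))"
proof -
  have 1: "sat N E (e(x := a, y := b)) \<phi> \<longleftrightarrow> sat N E (e(x := a)) \<phi>" for a b
    using assms by (intro sat_cong) auto
  have 2: "sat N E (e(x := a, y := b)) (inst \<phi> x y) \<longleftrightarrow> sat N E (e(x := b)) \<phi>" if "b \<in> N" for a b
    using assms that by (subst sat_inst) (auto intro!: sat_cong)
  have 3: "sat N E (e(x := a, y := b, z := c)) (inst \<phi> x z) \<longleftrightarrow> sat N E (e(x := c)) \<phi>"
    if "c \<in> N" for a b c
    using assms that by (subst sat_inst) (auto intro!: sat_cong)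
  have neq: "x \<noteq> y" "x \<noteq> z" "y \<noteq> z" "y \<noteq> x" "z \<noteq> x" "z \<noteq> y" using assms(1) by auto
  show ?thesis
    by (simp only: ind_def sat.simps sat_is_empty sat_is_adj fun_upd_same fun_upd_other neq 1 2 3 simp_thms cong: ball_cong)
qed


section \<open>Models of finite set theory\<close>

locale finite_set_model =
  fixes N :: "'a set" and E :: "'a \<Rightarrow> 'a \<Rightarrow> bool"
  assumes ext: "\<lbrakk>a \<in> N; b \<in> N; \<forall>u\<in>N. E u a \<longleftrightarrow> E u b\<rbrakk> \<Longrightarrow> a = b"
    and ex_empty: "\<exists>a\<in>N. \<forall>u\<in>N. \<not> E u a"
    and ex_adj: "\<lbrakk>a \<in> N; b \<in> N\<rbrakk> \<Longrightarrow> \<exists>c\<in>N. \<forall>u\<in>N. E u c \<longleftrightarrow> E u a \<or> u = b"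
    and induction: "\<lbrakk>distinct [x, y, z]; y \<notin> fv \<phi>; z \<notin> fv \<phi>; range e \<subseteq> N\<rbrakk>
      \<Longrightarrow> sat N E e (ind x y z \<phi>)"
begin

section \<open>Extensions and representable subsets\<close>

definition el :: "'a \<Rightarrow> 'a set" where
  "el a = {u \<in> N. E u a}"

text \<open>Existence of a set with a prescribed extension; each set-existence axiom thereby becomes
  a claim about subsets of \<open>N\<close>.\<close>

definition rep :: "'a set \<Rightarrow> bool" where
  "rep A \<longleftrightarrow> (\<exists>a\<in>N. el a = A)"

lemma el_subset: "el a \<subseteq> N"
  by (auto simp: el_def)

lemma el_inject: "\<lbrakk>a \<in> N; b \<in> N; el a = el b\<rbrakk> \<Longrightarrow> a = b"
  by (rule ext) (auto simp: el_def)

lemma mem_el: "u \<in> el a \<longleftrightarrow> u \<in> N \<and> E u a"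
  by (simp add: el_def)

lemma ball_el: "(\<forall>u\<in>el a. P u) \<longleftrightarrow> (\<forall>u\<in>N. E u a \<longrightarrow> P u)"
  by (auto simp: el_def)

lemma bex_el: "(\<exists>u\<in>el a. P u) \<longleftrightarrow> (\<exists>u\<in>N. E u a \<and> P u)"
  by (auto simp: el_def)

lemma el_subset_iff: "el a \<subseteq> el b \<longleftrightarrow> (\<forall>u\<in>N. E u a \<longrightarrow> E u b)"
  by (auto simp: el_def)

lemma el_empty_iff: "el a = {} \<longleftrightarrow> (\<forall>u\<in>N. \<not> E u a)"
  by (auto simp: el_def)

lemma rep_el: "a \<in> N \<Longrightarrow> rep (el a)"
  by (auto simp: rep_def)

text \<open>For definable \<open>A\<close> the right-hand side is first-order in the structure,
  which makes representability a property to which \<open>set_induct\<close> applies.\<close>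

lemma rep_iff:
  assumes "A \<subseteq> N"
  shows "rep A \<longleftrightarrow> (\<exists>a\<in>N. \<forall>u\<in>N. E u a \<longleftrightarrow> u \<in> A)"
proof -
  have "el a = A \<longleftrightarrow> (\<forall>u\<in>N. E u a \<longleftrightarrow> u \<in> A)" for a using assms by (auto simp: el_def)
  then show ?thesis by (simp add: rep_def)
qed

lemma rep_empty: "rep {}"
  using ex_empty by (auto simp: rep_def el_def)

lemma rep_insert:
  assumes "rep A" "b \<in> N"
  shows "rep (insert b A)"
proof -
  obtain a where a: "a \<in> N" "el a = A" using assms(1) by (auto simp: rep_def)
  obtain c where "c \<in> N" "\<forall>u\<in>N. E u c \<longleftrightarrow> E u a \<or> u = b" using ex_adj[OF a(1) assms(2)] by blast
  then have "el c = insert b A" using a(2) assms(2) by (auto simp: el_def)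
  then show ?thesis using \<open>c \<in> N\<close> by (auto simp: rep_def)
qed

text \<open>The first assumption says that \<open>P\<close> is definable, with the parameters given by \<open>e\<close>.\<close>

lemma set_induct:
  assumes "\<forall>a\<in>N. P a \<longleftrightarrow> sat N E (e(x := a)) \<phi>" and "range e \<subseteq> N" and "a \<in> N"
    and empty: "\<And>a. \<lbrakk>a \<in> N; el a = {}\<rbrakk> \<Longrightarrow> P a"
    and adj: "\<And>a b c. \<lbrakk>a \<in> N; b \<in> N; c \<in> N; el c = insert b (el a); P a; P b\<rbrakk> \<Longrightarrow> P c"
  shows "P a"
proof -
  \<comment> \<open>The auxiliary variables of the scheme \<open>ind x y z \<phi>\<close>, chosen
    fresh.\<close>
  obtain y where y: "y \<notin> fv \<phi>" "y \<notin> set [x]" by (rule fresh_variable)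
  obtain z where z: "z \<notin> fv \<phi>" "z \<notin> set [x, y]" by (rule fresh_variable)
  have "sat N E e (ind x y z \<phi>)" using y z assms(2) by (intro induction) auto
  moreover have "distinct [x, y, z]" using y z by auto
  moreover have "\<forall>a\<in>N. (\<forall>u\<in>N. \<not> E u a) \<longrightarrow> sat N E (e(x := a)) \<phi>"
    using empty assms(1) unfolding el_def by blast
  moreover have "sat N E (e(x := c)) \<phi>"
    if "a \<in> N" "b \<in> N" "c \<in> N" "sat N E (e(x := a)) \<phi>" "sat N E (e(x := b)) \<phi>"
      "\<forall>u\<in>N. E u c \<longleftrightarrow> E u a \<or> u = b" for a b c
  proof -
    have "el c = insert b (el a)" using that by (auto simp: el_def)
    then show ?thesis using adj[of a b c] that assms(1) by blast
  qed
  ultimately have "\<forall>a\<in>N. sat N E (e(x := a)) \<phi>"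
    using sat_ind[of x y z \<phi> N E e] y(1) z(1) by blast
  then show ?thesis using assms(1,3) by auto
qed

section \<open>Unions, replacement, separation and power sets\<close>

text \<open>Induction on \<open>b\<close>: adjoining an element to \<open>b\<close> adjoins the same
  element to the union.\<close>

lemma rep_Un:
  assumes "a \<in> N" "b \<in> N"
  shows "rep (el a \<union> el b)"
proof -
  \<comment> \<open>The constant environment stores the parameter \<open>a\<close>: variable 0 still
    denotes \<open>a\<close>, while variable 1 is the induction variable.\<close>
  have def: "\<forall>c\<in>N. rep (el a \<union> el c) \<longleftrightarrow> sat N E ((\<lambda>_. a)(1 := c)) (\<^bold>\<exists>2. \<^bold>\<forall>3. 3 \<^bold>\<in> 2 \<^bold>\<longleftrightarrow> 3 \<^bold>\<in> 0 \<^bold>\<or> 3 \<^bold>\<in> 1)"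
    using el_subset by (simp add: rep_iff mem_el cong: ball_cong)
  show ?thesis
  proof (rule set_induct[OF def const_range[OF assms(1)] assms(2)], goal_cases empty adj)
    case (empty c)
    then show ?case using assms(1) by (simp add: rep_el)
  next
    case (adj c d f)
    then show ?case using rep_insert by simp
  qed
qed

text \<open>Induction on \<open>a\<close>: adjoining \<open>d\<close> enlarges the union by
  \<open>el d\<close>, which is a case of \<open>rep_Un\<close>.\<close>

lemma rep_Union:
  assumes "a \<in> N"
  shows "rep (\<Union>(el ` el a))"
proof -
  have def: "\<forall>c\<in>N. rep (\<Union>(el ` el c)) \<longleftrightarrow>
      sat N E ((\<lambda>_. a)(0 := c)) (\<^bold>\<exists>1. \<^bold>\<forall>2. 2 \<^bold>\<in> 1 \<^bold>\<longleftrightarrow> (\<^bold>\<exists>3. 3 \<^bold>\<in> 0 \<^bold>\<and> 2 \<^bold>\<in> 3))"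
    using el_subset by (simp add: rep_iff UN_least mem_el bex_el cong: ball_cong)
  show ?thesis
  proof (rule set_induct[OF def const_range[OF assms] assms], goal_cases empty adj)
    case (empty c)
    then show ?case by (simp add: rep_empty)
  next
    case (adj c d f)
    then obtain g where "g \<in> N" "el g = \<Union>(el ` el c)" by (auto simp: rep_def)
    then show ?case using adj rep_Un[of d g] by simp
  qed
qed

text \<open>Induction on the domain \<open>a\<close>: by functionality, adjoining \<open>d\<close>
  adds at most one value to the image, so \<open>rep_insert\<close> suffices. The function may be
  partial.\<close>

lemma rep_replacement:
  assumes "range e \<subseteq> N" "a \<in> N" "x \<noteq> y"
    and functional: "\<And>u v w. \<lbrakk>u \<in> N; v \<in> N; w \<in> N; sat N E (e(x := u, y := v)) \<phi>;
      sat N E (e(x := u, y := w)) \<phi>\<rbrakk> \<Longrightarrow> v = w"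
  shows "rep {v \<in> N. \<exists>u\<in>el a. sat N E (e(x := u, y := v)) \<phi>}"
proof -
  \<comment> \<open>\<open>p\<close> will name the domain, which is the induction variable, and
    \<open>q\<close> the image; both must be invisible to \<open>\<phi>\<close>.\<close>
  obtain p where p: "p \<notin> fv \<phi>" "p \<notin> set [x, y]" by (rule fresh_variable)
  obtain q where q: "q \<notin> fv \<phi>" "q \<notin> set [x, y, p]" by (rule fresh_variable)
  have fresh: "sat N E (e(p := c, q := b, y := v, x := u)) \<phi> \<longleftrightarrow> sat N E (e(x := u, y := v)) \<phi>"
    for b c u v
    using p q assms(3) by (intro sat_cong) auto
  have def: "\<forall>c\<in>N. rep {v \<in> N. \<exists>u\<in>el c. sat N E (e(x := u, y := v)) \<phi>} \<longleftrightarrow>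
      sat N E (e(p := c)) (\<^bold>\<exists>q. \<^bold>\<forall>y. y \<^bold>\<in> q \<^bold>\<longleftrightarrow> (\<^bold>\<exists>x. x \<^bold>\<in> p \<^bold>\<and> \<phi>))"
    using p q assms(3) by (simp add: rep_iff bex_el fresh cong: ball_cong)
  show ?thesis
  proof (rule set_induct[OF def assms(1,2)], goal_cases empty adj)
    case (empty c)
    then show ?case by (simp add: rep_empty)
  next
    case (adj c d f)
    let ?A = "{v \<in> N. \<exists>u\<in>el c. sat N E (e(x := u, y := v)) \<phi>}"
    let ?B = "{v \<in> N. \<exists>u\<in>el f. sat N E (e(x := u, y := v)) \<phi>}"
    show ?case
    proof (cases "\<exists>v\<in>N. sat N E (e(x := d, y := v)) \<phi>")
      case True
      then obtain v where v: "v \<in> N" "sat N E (e(x := d, y := v)) \<phi>" by auto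
      then have "?B = insert v ?A" using adj functional by auto
      then show ?thesis using adj v rep_insert by simp
    next
      case False
      then have "?B = ?A" using adj by auto
      then show ?thesis using adj by simp
    qed
  qed
qed

lemma rep_separation:
  assumes "range e \<subseteq> N" "a \<in> N"
  shows "rep {u \<in> el a. sat N E (e(x := u)) \<phi>}"
proof -
  obtain y where y: "y \<notin> fv \<phi>" "y \<notin> set [x]" by (rule fresh_variable)
  have *: "sat N E (e(x := u, y := v)) (\<phi> \<^bold>\<and> x \<^bold>= y) \<longleftrightarrow> sat N E (e(x := u)) \<phi> \<and> u = v" for u v
    using y(2) sat_upd_fresh[OF y(1), of N E "e(x := u)" v] by simp
  have "rep {v \<in> N. \<exists>u\<in>el a. sat N E (e(x := u, y := v)) (\<phi> \<^bold>\<and> x \<^bold>= y)}"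
    using assms y by (intro rep_replacement) (auto simp only: * set_simps insert_iff)
  moreover have "{v \<in> N. \<exists>u\<in>el a. sat N E (e(x := u, y := v)) (\<phi> \<^bold>\<and> x \<^bold>= y)}
      = {u \<in> el a. sat N E (e(x := u)) \<phi>}"
    unfolding * using el_subset by auto
  ultimately show ?thesis by simp
qed

text \<open>Induction on \<open>a\<close>: a subset of \<open>c \<union> {d}\<close> is either a
  subset of \<open>c\<close> or of the form \<open>u \<union> {d}\<close> with
  \<open>u \<subseteq> c\<close>. Replacement turns the power set of \<open>c\<close> into the set
  of the latter.\<close>

lemma rep_Pow:
  assumes "a \<in> N"
  shows "rep {u \<in> N. el u \<subseteq> el a}"
proof -
  have def: "\<forall>c\<in>N. rep {u \<in> N. el u \<subseteq> el c} \<longleftrightarrow>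
      sat N E ((\<lambda>_. a)(0 := c)) (\<^bold>\<exists>1. \<^bold>\<forall>2. 2 \<^bold>\<in> 1 \<^bold>\<longleftrightarrow> is_sub 2 0)"
    by (simp add: rep_iff el_subset_iff cong: ball_cong)
  show ?thesis
  proof (rule set_induct[OF def const_range[OF assms] assms], goal_cases empty adj)
    case (empty c)
    have "{u \<in> N. el u \<subseteq> el c} = {c}" using empty el_inject by auto
    then show ?case using empty(1) rep_empty rep_insert by auto
  next
    case (adj c d f)
    then obtain p where p: "p \<in> N" "el p = {u \<in> N. el u \<subseteq> el c}" by (auto simp: rep_def)
    \<comment> \<open>The graph of \<open>u \<mapsto> u \<union> {d}\<close>: variable 0 is the
      argument, variable 1 the value, and variable 2 keeps the constant value
      \<open>d\<close>.\<close>
    have adj_iff: "sat N E ((\<lambda>_. d)(0 := u, 1 := v)) (is_adj 1 0 2) \<longleftrightarrow> el v = insert d (el u)" for u v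
      using adj(2) by (auto simp: el_def)
    have "rep {v \<in> N. \<exists>u\<in>el p. sat N E ((\<lambda>_. d)(0 := u, 1 := v)) (is_adj 1 0 2)}"
      using adj p by (intro rep_replacement) (auto simp only: adj_iff intro: el_inject)
    then obtain q where q: "q \<in> N" "el q = {v \<in> N. \<exists>u\<in>el p. el v = insert d (el u)}"
      unfolding adj_iff by (auto simp: rep_def)
    have "{u \<in> N. el u \<subseteq> el f} = el p \<union> el q"
    proof (intro equalityI subsetI)
      fix u assume "u \<in> {u \<in> N. el u \<subseteq> el f}"
      then have u: "u \<in> N" "el u \<subseteq> insert d (el c)" using adj by auto
      show "u \<in> el p \<union> el q"
      proof (cases "d \<in> el u")
        case True
        \<comment> \<open>The preimage of \<open>u\<close> is \<open>u - {d}\<close>, obtained by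
          separation; variable 1 denotes \<open>d\<close>.\<close>
        have "rep {w \<in> el u. sat N E ((\<lambda>_. d)(0 := w)) (\<^bold>\<not> 0 \<^bold>= 1)}"
          using u adj by (intro rep_separation) auto
        then obtain w where "w \<in> N" "el w = el u - {d}" by (auto simp: rep_def set_eq_iff)
        then have "el u = insert d (el w)" "el w \<subseteq> el c" using True u(2) by auto
        then show ?thesis using \<open>w \<in> N\<close> u(1) p(2) q(2) by auto
      qed (use u p in auto)
    qed (use p q adj in auto)
    then show ?case using rep_Un[OF p(1) q(1)] by simp
  qed
qed

section \<open>Membership induction, foundation and the failure of infinity\<close>

text \<open>\<open>set_induct\<close> is applied to the conjunction of \<open>P\<close> for a set
  and \<open>P\<close> for all its members. For \<open>c \<union> {d}\<close>, the hypothesis on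
  \<open>c\<close> covers the members of \<open>c\<close> and the hypothesis on \<open>d\<close>
  covers \<open>d\<close>; \<open>step\<close> then gives \<open>P\<close> for the set
  itself.\<close>

lemma mem_induct:
  assumes "\<forall>a\<in>N. P a \<longleftrightarrow> sat N E (e(x := a)) \<phi>" and "range e \<subseteq> N" and "a \<in> N"
    and step: "\<And>a. \<lbrakk>a \<in> N; \<And>u. u \<in> el a \<Longrightarrow> P u\<rbrakk> \<Longrightarrow> P a"
  shows "P a"
proof -
  obtain y where y: "y \<notin> fv \<phi>" "y \<notin> set [x]" by (rule fresh_variable)
  have fresh: "sat N E (e(y := c, x := u)) \<phi> \<longleftrightarrow> sat N E (e(x := u)) \<phi>" for c u
    using y(1) by (rule sat_upd_fresh2)
  have def: "\<forall>c\<in>N. P c \<and> (\<forall>u\<in>el c. P u) \<longleftrightarrow>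
      sat N E (e(y := c)) ((\<^bold>\<forall>x. x \<^bold>= y \<^bold>\<or> x \<^bold>\<in> y \<^bold>\<longrightarrow> \<phi>))"
    using y by (auto simp: mem_el assms(1) fresh)
  have "P a \<and> (\<forall>u\<in>el a. P u)"
  proof (rule set_induct[OF def assms(2,3)], goal_cases empty adj)
    case (empty c)
    then show ?case using step[of c] by auto
  next
    case (adj c d f)
    then show ?case using step[of f] by auto
  qed
  then show ?thesis ..
qed

text \<open>Membership induction on an element \<open>c\<close> of \<open>a\<close>: either
  \<open>c\<close> is itself minimal, or some member of \<open>c\<close> lies in \<open>a\<close>
  and the hypothesis applies to it.\<close>

lemma foundation:
  assumes "a \<in> N" "el a \<noteq> {}"
  shows "\<exists>m\<in>el a. \<forall>u\<in>el a. u \<notin> el m"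
proof -
  have def: "\<forall>c\<in>N. (c \<in> el a \<longrightarrow> (\<exists>m\<in>el a. \<forall>u\<in>el a. u \<notin> el m)) \<longleftrightarrow>
      sat N E ((\<lambda>_. a)(0 := c)) (0 \<^bold>\<in> 1 \<^bold>\<longrightarrow> (\<^bold>\<exists>2. 2 \<^bold>\<in> 1 \<^bold>\<and> (\<^bold>\<forall>3. 3 \<^bold>\<in> 1 \<^bold>\<longrightarrow> \<^bold>\<not> 3 \<^bold>\<in> 2)))"
    by (simp add: mem_el bex_el ball_el cong: ball_cong)
  have "c \<in> el a \<longrightarrow> (\<exists>m\<in>el a. \<forall>u\<in>el a. u \<notin> el m)" if "c \<in> N" for c
  proof (rule mem_induct[OF def const_range[OF assms(1)] that])
    fix c
    assume "\<And>u. u \<in> el c \<Longrightarrow> u \<in> el a \<longrightarrow> (\<exists>m\<in>el a. \<forall>u\<in>el a. u \<notin> el m)"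
    then show "c \<in> el a \<longrightarrow> (\<exists>m\<in>el a. \<forall>u\<in>el a. u \<notin> el m)" by blast
  qed
  then show ?thesis using assms el_subset by blast
qed

text \<open>Foundation applied to the singleton of \<open>a\<close>.\<close>

lemma mem_irrefl:
  assumes "a \<in> N" shows "a \<notin> el a"
proof -
  obtain b where "b \<in> N" "el b = {a}" using rep_insert[OF rep_empty assms] by (auto simp: rep_def)
  then show ?thesis using foundation[of b] by auto
qed

text \<open>Induction on \<open>a\<close>, carrying a maximal element \<open>m\<close> along: the
  adjoined \<open>d\<close> takes over if \<open>el m \<subseteq> el d\<close>, and otherwise
  \<open>m\<close> stays maximal.\<close>

lemma ex_maximal:
  assumes "a \<in> N" "el a \<noteq> {}"
  shows "\<exists>m\<in>el a. \<forall>u\<in>el a. el m \<subseteq> el u \<longrightarrow> el u \<subseteq> el m"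
proof -
  have def: "\<forall>c\<in>N. (el c \<noteq> {} \<longrightarrow> (\<exists>m\<in>el c. \<forall>u\<in>el c. el m \<subseteq> el u \<longrightarrow> el u \<subseteq> el m)) \<longleftrightarrow>
      sat N E ((\<lambda>_. a)(0 := c)) ((\<^bold>\<exists>1. 1 \<^bold>\<in> 0) \<^bold>\<longrightarrow>
        (\<^bold>\<exists>1. 1 \<^bold>\<in> 0 \<^bold>\<and> (\<^bold>\<forall>2. 2 \<^bold>\<in> 0 \<^bold>\<longrightarrow> is_sub 1 2 \<^bold>\<longrightarrow> is_sub 2 1)))"
    by (simp add: el_empty_iff bex_el ball_el el_subset_iff)
  have "el a \<noteq> {} \<longrightarrow> (\<exists>m\<in>el a. \<forall>u\<in>el a. el m \<subseteq> el u \<longrightarrow> el u \<subseteq> el m)"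
  proof (rule set_induct[OF def const_range[OF assms(1)] assms(1)], goal_cases empty adj)
    case (adj c d f)
    show ?case
    proof (cases "el c = {}")
      case False
      then obtain m where m: "m \<in> el c" "\<forall>u\<in>el c. el m \<subseteq> el u \<longrightarrow> el u \<subseteq> el m" using adj by auto
      show ?thesis
      proof (cases "el m \<subseteq> el d")
        case True
        \<comment> \<open>An old element \<open>u\<close> above \<open>d\<close> is also above
          \<open>m\<close>, hence below \<open>m\<close> by maximality, and so below
          \<open>d\<close>.\<close>
        have "el u \<subseteq> el d" if "u \<in> el f" "el d \<subseteq> el u" for u
        proof (cases "u = d")
          case False
          then have "el u \<subseteq> el m" using m(2) that adj(4) True by (metis insertE subset_trans)
          then show ?thesis using True by (rule subset_trans)
        qed simp
        then show ?thesis using adj(4) by auto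
      next
        case False
        then have "\<forall>u\<in>el f. el m \<subseteq> el u \<longrightarrow> el u \<subseteq> el m" using m(2) adj(4) by (metis insertE)
        then show ?thesis using adj(4) m by auto
      qed
    qed (use adj in auto)
  qed simp
  then show ?thesis using assms by auto
qed

text \<open>The successor of a maximal \<open>m\<close> lies above \<open>m\<close>, so maximality
  makes \<open>m\<close> a member of itself.\<close>

lemma no_inductive_set:
  assumes "w \<in> N" "el w \<noteq> {}" and suc: "\<And>a. a \<in> el w \<Longrightarrow> \<exists>b\<in>el w. el b = insert a (el a)"
  shows False
proof -
  obtain m where m: "m \<in> el w" "\<forall>u\<in>el w. el m \<subseteq> el u \<longrightarrow> el u \<subseteq> el m"
    using ex_maximal[OF assms(1,2)] by auto
  obtain b where "b \<in> el w" "el b = insert m (el m)" using suc[OF m(1)] by blast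
  then have "m \<in> el m" using m by auto
  then show False using mem_irrefl m(1) el_subset by blast
qed

section \<open>Transitive closures\<close>

definition trans_el :: "'a \<Rightarrow> bool" where
  "trans_el t \<longleftrightarrow> (\<forall>u\<in>el t. el u \<subseteq> el t)"

lemma sat_is_sub_el: "sat N E e (is_sub x y) \<longleftrightarrow> el (e x) \<subseteq> el (e y)"
  by (simp add: el_subset_iff)

lemma sat_is_trans_el: "sat N E e (is_trans x) \<longleftrightarrow> trans_el (e x)"
  by (simp add: trans_el_def ball_el el_subset_iff)

text \<open>The closure of \<open>c \<union> {d}\<close> consists of \<open>d\<close> and the
  closures of \<open>c\<close> and of \<open>d\<close>, so the induction hypothesis is used for the
  adjoined element as well.\<close>

lemma ex_trans_closure:
  assumes "a \<in> N"
  shows "\<exists>t\<in>N. el a \<subseteq> el t \<and> trans_el t \<and> (\<forall>s\<in>N. el a \<subseteq> el s \<and> trans_el s \<longrightarrow> el t \<subseteq> el s)"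
proof -
  have def: "\<forall>c\<in>N. (\<exists>t\<in>N. el c \<subseteq> el t \<and> trans_el t \<and> (\<forall>s\<in>N. el c \<subseteq> el s \<and> trans_el s \<longrightarrow> el t \<subseteq> el s)) \<longleftrightarrow>
      sat N E ((\<lambda>_. a)(0 := c)) (\<^bold>\<exists>1. is_sub 0 1 \<^bold>\<and> is_trans 1 \<^bold>\<and>
          (\<^bold>\<forall>2. is_sub 0 2 \<^bold>\<and> is_trans 2 \<^bold>\<longrightarrow> is_sub 1 2))"
    by (simp add: sat_is_sub_el sat_is_trans_el del: sat_is_sub sat_is_trans)
  show ?thesis
  proof (rule set_induct[OF def const_range[OF assms] assms], goal_cases empty adj)
    case (empty c)
    then show ?case by (intro bexI[of _ c]) (auto simp: trans_el_def)
  next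
    case (adj c d f)
    obtain s where s: "s \<in> N" "el c \<subseteq> el s" "trans_el s"
      "\<forall>r\<in>N. el c \<subseteq> el r \<and> trans_el r \<longrightarrow> el s \<subseteq> el r" using adj by auto
    obtain t where t: "t \<in> N" "el d \<subseteq> el t" "trans_el t"
      "\<forall>r\<in>N. el d \<subseteq> el r \<and> trans_el r \<longrightarrow> el t \<subseteq> el r" using adj by auto
    obtain q where q: "q \<in> N" "el q = insert d (el s \<union> el t)"
      using rep_insert[OF rep_Un[OF s(1) t(1)] adj(2)] by (auto simp: rep_def)
    have "el f \<subseteq> el q" using s q adj(4) by auto
    moreover have "trans_el q" using s(3) t(2,3) q(2) by (auto simp: trans_el_def)
    moreover have "el q \<subseteq> el r" if r: "r \<in> N" "el f \<subseteq> el r" "trans_el r" for r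
    proof -
      \<comment> \<open>A transitive \<open>r\<close> that contains \<open>d\<close> also includes
        \<open>d\<close>, so minimality of the closure \<open>t\<close> of \<open>d\<close>
        applies.\<close>
      have "d \<in> el r" "el c \<subseteq> el r" using r adj(4) by auto
      moreover from this have "el d \<subseteq> el r" using r by (auto simp: trans_el_def)
      ultimately show ?thesis using s(4) t(4) r q(2) by auto
    qed
    ultimately show ?case using q(1) by blast
  qed
qed

section \<open>Verification of the axioms of finite ZF\<close>

lemma N_nonempty: "N \<noteq> {}"
  using ex_empty by auto

lemma sat_ZF_Separation:
  assumes "\<phi> \<in> ZF_Separation"
  shows "sat N E e \<phi>"
proof -
  obtain \<psi> a b x where \<phi>: "\<phi> = closure (\<^bold>\<forall>a. \<^bold>\<exists>b. \<^bold>\<forall>x. x \<^bold>\<in> b \<^bold>\<longleftrightarrow> x \<^bold>\<in> a \<^bold>\<and> \<psi>)"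
    and d: "distinct [a, b, x]" "b \<notin> fv \<psi>"
    using assms by (auto simp: ZF_Separation_def)
  have "\<exists>B\<in>N. \<forall>X\<in>N. E X B \<longleftrightarrow> E X A \<and> sat N E (f(a := A, b := B, x := X)) \<psi>"
    if f: "range f \<subseteq> N" "A \<in> N" for f A
  proof -
    have "sat N E (f(a := A, b := B, x := X)) \<psi> \<longleftrightarrow> sat N E (f(a := A, x := X)) \<psi>" for B X
      using d(2) by (rule sat_upd_fresh2)
    moreover have "rep {u \<in> el A. sat N E (f(a := A, x := u)) \<psi>}"
      using f by (intro rep_separation range_upd)
    ultimately show ?thesis using el_subset by (subst (asm) rep_iff) (auto simp: mem_el cong: ball_cong)
  qed
  then show ?thesis using d(1) by (simp add: \<phi> sat_closure[OF N_nonempty])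
qed

lemma sat_ZF_Replacement:
  assumes "\<phi> \<in> ZF_Replacement"
  shows "sat N E e \<phi>"
proof -
  obtain \<psi> a b x y z where \<phi>: "\<phi> = closure (\<^bold>\<forall>a. (\<^bold>\<forall>x. \<^bold>\<forall>y. \<^bold>\<forall>z. \<psi> \<^bold>\<and> inst \<psi> y z \<^bold>\<longrightarrow> y \<^bold>= z) \<^bold>\<longrightarrow>
                (\<^bold>\<exists>b. \<^bold>\<forall>y. y \<^bold>\<in> b \<^bold>\<longleftrightarrow> (\<^bold>\<exists>x. x \<^bold>\<in> a \<^bold>\<and> \<psi>)))"
    and d: "distinct [a, b, x, y, z]" "b \<notin> fv \<psi>" "z \<notin> fv \<psi>"
    using assms unfolding ZF_Replacement_def by blast
  have 1: "sat N E (f(a := A, x := u, y := v, z := w)) \<psi> \<longleftrightarrow> sat N E (f(a := A, x := u, y := v)) \<psi>"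
    for f A u v w
    using d by (intro sat_cong) auto
  have 2: "sat N E (f(a := A, x := u, y := v, z := w)) (inst \<psi> y z) \<longleftrightarrow>
      sat N E (f(a := A, x := u, y := w)) \<psi>" if "w \<in> N" for f A u v w
    using d that by (subst sat_inst) (auto intro!: sat_cong)
  have 3: "sat N E (f(a := A, b := B, y := v, x := u)) \<psi> \<longleftrightarrow> sat N E (f(a := A, x := u, y := v)) \<psi>"
    for f A B u v
    using d by (intro sat_cong) auto
  have "\<exists>B\<in>N. \<forall>v\<in>N. E v B \<longleftrightarrow> (\<exists>u\<in>N. E u A \<and> sat N E (f(a := A, x := u, y := v)) \<psi>)"
    if f: "range f \<subseteq> N" "A \<in> N" and fn: "\<forall>u\<in>N. \<forall>v\<in>N. \<forall>w\<in>N.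
      sat N E (f(a := A, x := u, y := v)) \<psi> \<and> sat N E (f(a := A, x := u, y := w)) \<psi> \<longrightarrow> v = w" for f A
  proof -
    have "rep {v \<in> N. \<exists>u\<in>el A. sat N E (f(a := A, x := u, y := v)) \<psi>}"
    proof (rule rep_replacement)
      show "range (f(a := A)) \<subseteq> N" using f by (rule range_upd)
    qed (use f fn d in auto)
    then show ?thesis by (simp add: rep_iff bex_el cong: ball_cong)
  qed
  then show ?thesis using d(1) by (simp add: \<phi> sat_closure[OF N_nonempty] 1 2 3)
qed

text \<open>The axioms are sentences, so the environment is left arbitrary; relativized axioms will
  be evaluated in environments with values outside \<open>N\<close>.\<close>

theorem sat_ZF_fin:
  assumes "\<phi> \<in> ZF_fin"
  shows "sat N E e \<phi>"
proof -
  have "sat N E e ZF_Ext" using ext by (auto simp: ZF_Ext_def)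
  moreover have "sat N E e ZF_Empty" using ex_empty by (auto simp: ZF_Empty_def)
  moreover have "sat N E e ZF_Pair"
  proof -
    have "\<exists>c\<in>N. \<forall>u\<in>N. E u c \<longleftrightarrow> u = a \<or> u = b" if "a \<in> N" "b \<in> N" for a b
      using rep_insert[OF rep_insert[OF rep_empty that(2)] that(1)] that by (simp add: rep_iff)
    then show ?thesis by (simp add: ZF_Pair_def)
  qed
  moreover have "sat N E e ZF_Union"
  proof -
    have "\<exists>b\<in>N. \<forall>u\<in>N. E u b \<longleftrightarrow> (\<exists>v\<in>N. E v a \<and> E u v)" if "a \<in> N" for a
      using rep_Union[OF that] el_subset by (simp add: rep_iff UN_least mem_el bex_el cong: ball_cong)
    then show ?thesis by (simp add: ZF_Union_def)
  qed
  moreover have "sat N E e ZF_Power"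
  proof -
    have "\<exists>b\<in>N. \<forall>u\<in>N. E u b \<longleftrightarrow> (\<forall>v\<in>N. E v u \<longrightarrow> E v a)" if "a \<in> N" for a
      using rep_Pow[OF that] by (simp add: rep_iff el_subset_iff cong: ball_cong)
    then show ?thesis by (simp add: ZF_Power_def)
  qed
  moreover have "sat N E e ZF_Foundation"
  proof -
    have "\<exists>m\<in>N. E m a \<and> (\<forall>u\<in>N. E u a \<longrightarrow> \<not> E u m)" if "a \<in> N" "\<exists>b\<in>N. E b a" for a
      using foundation[OF that(1)] that(2) by (auto simp: el_def)
    then show ?thesis by (simp add: ZF_Foundation_def)
  qed
  moreover have "\<not> sat N E e ZF_Infinity"
  proof
    assume "sat N E e ZF_Infinity"
    then obtain w where w: "w \<in> N" "\<exists>z\<in>N. E z w"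
      "\<forall>a\<in>N. E a w \<longrightarrow> (\<exists>b\<in>N. (\<forall>u\<in>N. E u b \<longleftrightarrow> E u a \<or> u = a) \<and> E b w)"
      by (auto simp: ZF_Infinity_def)
    show False
    proof (rule no_inductive_set[OF w(1)])
      fix a assume "a \<in> el w"
      then show "\<exists>b\<in>el w. el b = insert a (el a)" using w(3) by (fastforce simp: el_def)
    qed (use w in \<open>auto simp: el_def\<close>)
  qed
  moreover have "sat N E e Trans_Closure"
    using ex_trans_closure
    by (simp add: Trans_Closure_def sat_is_sub_el sat_is_trans_el del: sat_is_sub sat_is_trans)
  ultimately show ?thesis
    using assms sat_ZF_Separation sat_ZF_Replacement by (auto simp: ZF_fin_def)
qed

end


section \<open>Sets and standard sets in a model of TFS\<close>

locale TFS_model =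
  fixes M :: "'a set" and E :: "'a \<Rightarrow> 'a \<Rightarrow> bool"
  assumes models_TFS: "models M E TFS"
begin

section \<open>The universe of all sets\<close>

definition H :: "'a set" where
  "H = {a \<in> M. \<exists>b\<in>M. E a b}"

lemma M_nonempty: "M \<noteq> {}"
  using models_TFS by (simp add: models_def)

lemma sat_TFS: "\<lbrakk>\<phi> \<in> TFS; range e \<subseteq> M\<rbrakk> \<Longrightarrow> sat M E e \<phi>"
  using models_TFS by (simp add: models_def)

lemma HI: "\<lbrakk>E a b; a \<in> M; b \<in> M\<rbrakk> \<Longrightarrow> a \<in> H"
  by (auto simp: H_def)

lemma H_subset: "H \<subseteq> M"
  by (auto simp: H_def)

lemma class_ext:
  assumes "X \<in> M" "Y \<in> M" "\<And>a. a \<in> H \<Longrightarrow> E a X \<longleftrightarrow> E a Y"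
  shows "X = Y"
proof -
  have "sat M E (\<lambda>_. X) TFS_Ext" using assms by (intro sat_TFS) (auto simp: TFS_def)
  then show ?thesis using assms by (auto simp: TFS_Ext_def H_def)
qed

text \<open>The quantifiers of \<open>\<phi>\<close> range over all classes in \<open>M\<close>.
  This impredicativity admits formulas built from \<open>is_std\<close>, which itself quantifies
  over classes.\<close>

lemma class_comprehension:
  assumes "range e \<subseteq> M"
  shows "\<exists>Y\<in>M. \<forall>a\<in>H. E a Y \<longleftrightarrow> sat M E (e(y := a)) \<phi>"
proof -
  obtain Y where Y: "Y \<notin> fv \<phi>" "Y \<notin> set [y]" by (rule fresh_variable)
  have "sat M E e (closure (\<^bold>\<exists>Y. \<^bold>\<forall>y. is_set y \<^bold>\<longrightarrow> (y \<^bold>\<in> Y \<^bold>\<longleftrightarrow> \<phi>)))"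
    using assms Y by (intro sat_TFS) (auto simp: TFS_def TFS_Class_def)
  then have "sat M E e (\<^bold>\<exists>Y. \<^bold>\<forall>y. is_set y \<^bold>\<longrightarrow> (y \<^bold>\<in> Y \<^bold>\<longleftrightarrow> \<phi>))"
    using assms by (simp only: sat_closure[OF M_nonempty])
  then show ?thesis using Y by (auto simp: sat_upd_fresh2 H_def)
qed

lemma sat_rel_is_set: "range e \<subseteq> M \<Longrightarrow> sat M E e (rel is_set \<phi>) \<longleftrightarrow> sat H E e \<phi>"
  by (rule sat_rel[of M]) (auto simp: H_def)

lemma ex_empty_set: "\<exists>z\<in>H. \<forall>u\<in>M. \<not> E u z"
proof -
  obtain n where "n \<in> M" using M_nonempty by auto
  then have "sat M E (\<lambda>_. n) TFS_Set_empty" by (intro sat_TFS) (auto simp: TFS_def)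
  then show ?thesis by (auto simp: TFS_Set_empty_def H_def)
qed

lemma ex_adj_set:
  assumes "a \<in> H" "b \<in> H"
  shows "\<exists>c\<in>H. \<forall>u\<in>M. E u c \<longleftrightarrow> E u a \<or> u = b"
proof -
  have "sat M E (\<lambda>_. a) TFS_Set_adj" using assms H_subset by (intro sat_TFS) (auto simp: TFS_def)
  then have "\<forall>a\<in>M. \<forall>b\<in>M. (\<exists>c\<in>M. E a c) \<and> (\<exists>c\<in>M. E b c) \<longrightarrow>
      (\<exists>c\<in>M. (\<forall>u\<in>M. E u c \<longleftrightarrow> E u a \<or> u = b) \<and> (\<exists>d\<in>M. E c d))"
    by (simp add: TFS_Set_adj_def)
  then show ?thesis using assms by (simp add: H_def) blast
qed

sublocale H: finite_set_model H E
proof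
  fix a b assume "a \<in> H" "b \<in> H" "\<forall>u\<in>H. E u a \<longleftrightarrow> E u b"
  then show "a = b" using H_subset by (intro class_ext) auto
next
  show "\<exists>a\<in>H. \<forall>u\<in>H. \<not> E u a" using ex_empty_set H_subset by blast
next
  fix a b assume "a \<in> H" "b \<in> H"
  then show "\<exists>c\<in>H. \<forall>u\<in>H. E u c \<longleftrightarrow> E u a \<or> u = b" using ex_adj_set[of a b] H_subset by blast
next
  fix x y z \<phi> and e :: "nat \<Rightarrow> 'a"
  assume *: "distinct [x, y, z]" "y \<notin> fv \<phi>" "z \<notin> fv \<phi>" "range e \<subseteq> H"
  then have e: "range e \<subseteq> M" using H_subset by auto
  have "rel is_set (closure (ind x y z \<phi>)) \<in> TFS_Ind" using *(1-3) unfolding TFS_Ind_def by blast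
  then have "sat M E e (rel is_set (closure (ind x y z \<phi>)))"
    using e by (intro sat_TFS) (auto simp: TFS_def)
  \<comment> \<open>Relativizing the closure, and not only its matrix, lets the parameters range
    over \<open>H\<close>.\<close>
  then have "sat H E e (closure (ind x y z \<phi>))" using e by (simp only: sat_rel_is_set)
  moreover have "H \<noteq> {}" using ex_empty_set by auto
  ultimately have "\<forall>f. range f \<subseteq> H \<longrightarrow> sat H E f (ind x y z \<phi>)" by (simp only: sat_closure not_False_eq_True)
  then show "sat H E e (ind x y z \<phi>)" using *(4) by iprover
qed

section \<open>The universe of standard sets\<close>

definition inductive_class :: "'a \<Rightarrow> bool" where
  "inductive_class X \<longleftrightarrow> (\<exists>a\<in>M. (\<forall>u\<in>M. \<not> E u a) \<and> E a X) \<and>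
     (\<forall>a\<in>M. \<forall>b\<in>M. E a X \<and> E b X \<longrightarrow> (\<exists>c\<in>M. (\<forall>u\<in>M. E u c \<longleftrightarrow> E u a \<or> u = b) \<and> E c X))"

definition S :: "'a set" where
  "S = {a \<in> H. \<forall>X\<in>M. inductive_class X \<longrightarrow> E a X}"

lemma S_subset: "S \<subseteq> H"
  by (auto simp: S_def)

lemma sat_is_std:
  assumes "range e \<subseteq> M"
  shows "sat M E e (is_std x) \<longleftrightarrow> e x \<in> S"
proof -
  have "e x \<in> M" using assms by auto
  then show ?thesis by (simp add: is_std_def Let_def S_def H_def inductive_class_def)
qed

lemma sat_rel_is_std: "range e \<subseteq> M \<Longrightarrow> sat M E e (rel is_std \<phi>) \<longleftrightarrow> sat S E e \<phi>"
  using S_subset H_subset by (intro sat_rel[of M]) (auto simp: sat_is_std)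

text \<open>An inductive class contains some empty set, and extensionality identifies it with
  \<open>a\<close>. The same argument serves for adjunction in \<open>adj_in_S\<close>.\<close>

lemma empty_in_S: "\<lbrakk>a \<in> M; \<forall>u\<in>M. \<not> E u a\<rbrakk> \<Longrightarrow> a \<in> S"
proof -
  assume a: "a \<in> M" "\<forall>u\<in>M. \<not> E u a"
  have eq: "b = a" if "b \<in> M" "\<forall>u\<in>M. \<not> E u b" for b
    using a that H_subset by (intro class_ext) auto
  have "a \<in> H" using ex_empty_set eq H_subset by blast
  moreover have "E a X" if "X \<in> M" "inductive_class X" for X
    using that eq unfolding inductive_class_def by blast
  ultimately show ?thesis by (auto simp: S_def)
qed

lemma adj_in_S:
  assumes "a \<in> S" "b \<in> S" "c \<in> M" "\<forall>u\<in>M. E u c \<longleftrightarrow> E u a \<or> u = b"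
  shows "c \<in> S"
proof -
  have eq: "d = c" if "d \<in> M" "\<forall>u\<in>M. E u d \<longleftrightarrow> E u a \<or> u = b" for d
    using assms that H_subset by (intro class_ext) auto
  have ab: "a \<in> H" "b \<in> H" using assms S_subset by auto
  then have "c \<in> H" using ex_adj_set[of a b] eq H_subset by blast
  moreover have "E c X" if "X \<in> M" "inductive_class X" for X
  proof -
    have "E a X" "E b X" "a \<in> M" "b \<in> M" using assms that ab H_subset by (auto simp: S_def)
    then show ?thesis using that eq unfolding inductive_class_def by blast
  qed
  ultimately show ?thesis by (auto simp: S_def)
qed

text \<open>The standard sets with property \<open>P\<close> form a class by comprehension; this
  class is inductive, so it contains every standard set.\<close>

lemma S_induct:
  assumes "\<forall>a\<in>S. P a \<longleftrightarrow> sat M E (e(x := a)) \<phi>" and "range e \<subseteq> M" and "a \<in> S"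
    and empty: "\<And>a. \<lbrakk>a \<in> S; \<forall>u\<in>M. \<not> E u a\<rbrakk> \<Longrightarrow> P a"
    and adj: "\<And>a b c. \<lbrakk>a \<in> S; b \<in> S; c \<in> S; \<forall>u\<in>M. E u c \<longleftrightarrow> E u a \<or> u = b; P a; P b\<rbrakk> \<Longrightarrow> P c"
  shows "P a"
proof -
  \<comment> \<open>The conjunct \<open>is_std x\<close> confines \<open>X\<close> to
    \<open>S\<close>, where \<open>\<phi>\<close> defines \<open>P\<close> and where
    \<open>adj\<close> can be applied.\<close>
  obtain X where X: "X \<in> M" "\<forall>a\<in>H. E a X \<longleftrightarrow> sat M E (e(x := a)) (is_std x \<^bold>\<and> \<phi>)"
    using class_comprehension[OF assms(2)] by blast
  have X_iff: "E a X \<longleftrightarrow> a \<in> S \<and> P a" if "a \<in> M" for a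
  proof (cases "a \<in> H")
    case True
    have "range (e(x := a)) \<subseteq> M" using assms(2) that by (rule range_upd)
    then show ?thesis using X(2) True assms(1) by (auto simp: sat_is_std)
  next
    case False
    then show ?thesis using S_subset HI[OF _ that X(1)] by auto
  qed
  have "inductive_class X"
    unfolding inductive_class_def
  proof (intro conjI ballI impI)
    obtain z where "z \<in> H" "\<forall>u\<in>M. \<not> E u z" using ex_empty_set by auto
    then show "\<exists>a\<in>M. (\<forall>u\<in>M. \<not> E u a) \<and> E a X"
      using X_iff empty_in_S empty H_subset by blast
  next
    fix a b assume ab: "a \<in> M" "b \<in> M" "E a X \<and> E b X"
    then have S: "a \<in> S" "b \<in> S" "P a" "P b" using X_iff by auto
    then obtain c where c: "c \<in> M" "\<forall>u\<in>M. E u c \<longleftrightarrow> E u a \<or> u = b"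
      using ex_adj_set[of a b] S_subset H_subset by blast
    then have "c \<in> S" using S adj_in_S by blast
    then show "\<exists>c\<in>M. (\<forall>u\<in>M. E u c \<longleftrightarrow> E u a \<or> u = b) \<and> E c X"
      using adj[OF S(1,2) _ c(2) S(3,4)] X_iff c by blast
  qed
  then have "E a X" using assms(3) X(1) by (auto simp: S_def)
  then show ?thesis using X_iff assms(3) S_subset H_subset by auto
qed

text \<open>Induction on \<open>a\<close>: a member of \<open>c \<union> {d}\<close> is a member of
  \<open>c\<close> or the standard set \<open>d\<close>.\<close>

lemma S_transitive:
  assumes "a \<in> S" "u \<in> M" "E u a"
  shows "u \<in> S"
proof -
  have a: "a \<in> M" using assms S_subset H_subset by auto
  have def: "\<forall>c\<in>S. (\<forall>u\<in>M. E u c \<longrightarrow> u \<in> S) \<longleftrightarrow>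
      sat M E ((\<lambda>_. a)(0 := c)) (\<^bold>\<forall>1. 1 \<^bold>\<in> 0 \<^bold>\<longrightarrow> is_std 1)"
  proof
    fix c assume "c \<in> S"
    then have "range ((\<lambda>_. a)(0 := c, 1 := u)) \<subseteq> M" if "u \<in> M" for u
      using a that S_subset H_subset by auto
    from sat_is_std[OF this, of _ 1] show "(\<forall>u\<in>M. E u c \<longrightarrow> u \<in> S) \<longleftrightarrow>
      sat M E ((\<lambda>_. a)(0 := c)) (\<^bold>\<forall>1. 1 \<^bold>\<in> 0 \<^bold>\<longrightarrow> is_std 1)" by simp
  qed
  have "\<forall>u\<in>M. E u a \<longrightarrow> u \<in> S"
    by (rule S_induct[OF def const_range[OF a] assms(1)]) auto
  then show ?thesis using assms by auto
qed

text \<open>Transitivity turns agreement on \<open>S\<close> into agreement on all sets, which gives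
  extensionality. The induction scheme comes from \<open>S_induct\<close>.\<close>

sublocale S: finite_set_model S E
proof
  fix a b assume "a \<in> S" "b \<in> S" "\<forall>u\<in>S. E u a \<longleftrightarrow> E u b"
  then show "a = b" using S_transitive S_subset H_subset by (intro class_ext) blast+
next
  show "\<exists>a\<in>S. \<forall>u\<in>S. \<not> E u a" using ex_empty_set empty_in_S S_subset H_subset by blast
next
  fix a b assume ab: "a \<in> S" "b \<in> S"
  then obtain c where c: "c \<in> H" "\<forall>u\<in>M. E u c \<longleftrightarrow> E u a \<or> u = b"
    using ex_adj_set[of a b] S_subset by blast
  moreover from this have "c \<in> S" using adj_in_S[of a b c] ab H_subset by blast
  ultimately show "\<exists>c\<in>S. \<forall>u\<in>S. E u c \<longleftrightarrow> E u a \<or> u = b" using S_subset H_subset by blast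
next
  fix x y z \<phi> and e :: "nat \<Rightarrow> 'a"
  assume *: "distinct [x, y, z]" "y \<notin> fv \<phi>" "z \<notin> fv \<phi>" "range e \<subseteq> S"
  then have e: "range e \<subseteq> M" using S_subset H_subset by auto
  show "sat S E e (ind x y z \<phi>)"
    unfolding sat_ind[OF *(1-3)]
  proof (intro impI ballI, elim conjE)
    fix a assume a: "a \<in> S"
      and empty: "\<forall>a\<in>S. (\<forall>u\<in>S. \<not> E u a) \<longrightarrow> sat S E (e(x := a)) \<phi>"
      and adj: "\<forall>a\<in>S. \<forall>b\<in>S. sat S E (e(x := a)) \<phi> \<and> sat S E (e(x := b)) \<phi> \<longrightarrow>
       (\<forall>c\<in>S. (\<forall>u\<in>S. E u c \<longleftrightarrow> E u a \<or> u = b) \<longrightarrow> sat S E (e(x := c)) \<phi>)"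
    \<comment> \<open>Relativization expresses truth in \<open>S\<close> as truth in
      \<open>M\<close>, the form of definability that \<open>S_induct\<close> requires.\<close>
    have def: "\<forall>c\<in>S. sat S E (e(x := c)) \<phi> \<longleftrightarrow> sat M E (e(x := c)) (rel is_std \<phi>)"
    proof
      fix c assume "c \<in> S"
      then have "range (e(x := c)) \<subseteq> M" using S_subset H_subset by (intro range_upd[OF e]) auto
      then show "sat S E (e(x := c)) \<phi> \<longleftrightarrow> sat M E (e(x := c)) (rel is_std \<phi>)"
        by (simp only: sat_rel_is_std)
    qed
    show "sat S E (e(x := a)) \<phi>"
    proof (rule S_induct[OF def e a])
      fix c assume "c \<in> S" "\<forall>u\<in>M. \<not> E u c"
      then show "sat S E (e(x := c)) \<phi>" using empty S_subset H_subset by blast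
    next
      fix c d f
      assume *: "c \<in> S" "d \<in> S" "f \<in> S" "\<forall>u\<in>M. E u f \<longleftrightarrow> E u c \<or> u = d"
        "sat S E (e(x := c)) \<phi>" "sat S E (e(x := d)) \<phi>"
      then have "\<forall>u\<in>S. E u f \<longleftrightarrow> E u c \<or> u = d" using S_subset H_subset by blast
      then show "sat S E (e(x := f)) \<phi>" using adj * by blast
    qed
  qed
qed

section \<open>The universe of classes of standard sets\<close>

definition C :: "'a set" where
  "C = {X \<in> M. \<forall>a\<in>M. E a X \<longrightarrow> a \<in> S}"

lemma C_subset: "C \<subseteq> M"
  by (auto simp: C_def)

text \<open>Transitivity of \<open>S\<close> makes each standard set a subclass of
  \<open>S\<close>.\<close>

lemma S_subset_C: "S \<subseteq> C"
  using S_transitive S_subset H_subset by (auto simp: C_def)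

lemma sat_is_std_class:
  assumes "range e \<subseteq> M"
  shows "sat M E e (is_std_class X) \<longleftrightarrow> e X \<in> C"
  using sat_is_std[OF range_upd[OF assms]] assms by (auto simp: is_std_class_def C_def)

lemma sat_rel_is_std_class: "range e \<subseteq> M \<Longrightarrow> sat M E e (rel is_std_class \<phi>) \<longleftrightarrow> sat C E e \<phi>"
  using C_subset by (intro sat_rel[of M]) (auto simp: sat_is_std_class)

text \<open>Comprehension in \<open>M\<close> with two conjuncts: \<open>is_std y\<close> puts the
  class into \<open>C\<close>, and \<open>rel is_std_class \<phi>\<close> evaluates
  \<open>\<phi>\<close> in \<open>C\<close>.\<close>

lemma std_class_comprehension:
  assumes "range e \<subseteq> M"
  shows "\<exists>Y\<in>C. \<forall>a\<in>S. E a Y \<longleftrightarrow> sat C E (e(y := a)) \<phi>"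
proof -
  obtain Y where Y: "Y \<in> M" "\<forall>a\<in>H. E a Y \<longleftrightarrow> sat M E (e(y := a)) (is_std y \<^bold>\<and> rel is_std_class \<phi>)"
    using class_comprehension[OF assms] by blast
  have Y_iff: "E a Y \<longleftrightarrow> a \<in> S \<and> sat C E (e(y := a)) \<phi>" if "a \<in> H" for a
    using Y(2) that range_upd[OF assms, of a y] H_subset
    by (auto simp: sat_is_std sat_rel_is_std_class)
  then have "Y \<in> C" using Y(1) HI by (auto simp: C_def)
  then show ?thesis using Y_iff S_subset by blast
qed

text \<open>Comprehension for a true formula yields the class of all standard sets as an element of
  \<open>C\<close>. It witnesses that standard sets are sets in the sense of
  \<open>C\<close>.\<close>

lemma std_class_containing_S: "\<exists>X\<in>C. \<forall>a\<in>S. E a X"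
proof -
  obtain n where "n \<in> M" using M_nonempty by auto
  then have "\<exists>X\<in>C. \<forall>a\<in>S. E a X \<longleftrightarrow> sat C E ((\<lambda>_. n)(0 := a)) (0 \<^bold>= 0)"
    by (intro std_class_comprehension) auto
  then show ?thesis by simp
qed

lemma sat_C_is_set: "range e \<subseteq> M \<Longrightarrow> sat C E e (is_set x) \<longleftrightarrow> e x \<in> S"
  using std_class_containing_S by (auto simp: C_def)

lemma C_nonempty: "C \<noteq> {}"
  using std_class_containing_S by auto

lemma sat_C_Class:
  assumes "\<phi> \<in> TFS_Class"
  shows "sat C E e \<phi>"
proof -
  obtain \<psi> y Y where \<phi>: "\<phi> = closure (\<^bold>\<exists>Y. \<^bold>\<forall>y. is_set y \<^bold>\<longrightarrow> (y \<^bold>\<in> Y \<^bold>\<longleftrightarrow> \<psi>))"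
    and d: "y \<noteq> Y" "Y \<notin> fv \<psi>"
    using assms by (auto simp: TFS_Class_def)
  have "sat C E f (\<^bold>\<exists>Y. \<^bold>\<forall>y. is_set y \<^bold>\<longrightarrow> (y \<^bold>\<in> Y \<^bold>\<longleftrightarrow> \<psi>))" if f: "range f \<subseteq> C" for f
  proof -
    have fM: "range f \<subseteq> M" using f C_subset by auto
    obtain X where X: "X \<in> C" "\<forall>a\<in>S. E a X \<longleftrightarrow> sat C E (f(y := a)) \<psi>"
      using std_class_comprehension[OF fM] by blast
    have "(\<exists>b\<in>C. E a b) \<longrightarrow> (E a X \<longleftrightarrow> sat C E (f(Y := X, y := a)) \<psi>)" if "a \<in> C" for a
      using X(2) that d(2) by (auto simp: sat_upd_fresh2 C_def)
    then show ?thesis using X(1) d(1) by auto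
  qed
  then show ?thesis by (simp only: \<phi> sat_closure[OF C_nonempty]) blast
qed

text \<open>The sets of the structure \<open>C\<close> are exactly the elements of \<open>S\<close>.
  Hence the set axioms reduce to the closure properties of \<open>S\<close>, and induction to the
  scheme already proved for \<open>S\<close>.\<close>

theorem sat_C_TFS:
  assumes "\<phi> \<in> TFS" "range e \<subseteq> M"
  shows "sat C E e \<phi>"
proof -
  have set_iff: "(\<exists>b\<in>C. E a b) \<longleftrightarrow> a \<in> S" if "a \<in> M" for a
    using that std_class_containing_S by (auto simp: C_def)
  have "sat C E e TFS_Ext"
  proof -
    have "X = Y" if "X \<in> C" "Y \<in> C" "\<forall>a\<in>C. (\<exists>b\<in>C. E a b) \<longrightarrow> (E a X \<longleftrightarrow> E a Y)" for X Y
    proof (rule class_ext)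
      fix a assume a: "a \<in> H"
      show "E a X \<longleftrightarrow> E a Y"
      proof (cases "a \<in> S")
        case True
        then show ?thesis using that(3) set_iff S_subset_C C_subset by blast
      next
        case False
        \<comment> \<open>A set outside \<open>S\<close> belongs to no class in \<open>C\<close>, so
          both sides are false.\<close>
        then show ?thesis using a that(1,2) H_subset by (auto simp: C_def)
      qed
    qed (use that C_subset in auto)
    then show ?thesis by (simp add: TFS_Ext_def)
  qed
  moreover have "sat C E e TFS_Set_empty"
  proof -
    obtain z where z: "z \<in> H" "\<forall>u\<in>M. \<not> E u z" using ex_empty_set by auto
    then have "z \<in> S" using empty_in_S H_subset by auto
    then have "z \<in> C" "\<exists>b\<in>C. E z b" "\<forall>u\<in>C. \<not> E u z"
      using z set_iff S_subset_C C_subset by blast+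
    then show ?thesis by (auto simp: TFS_Set_empty_def)
  qed
  moreover have "sat C E e TFS_Set_adj"
  proof -
    have "\<exists>c\<in>C. (\<forall>u\<in>C. E u c \<longleftrightarrow> E u a \<or> u = b) \<and> (\<exists>d\<in>C. E c d)"
      if "a \<in> C" "b \<in> C" "\<exists>c\<in>C. E a c" "\<exists>c\<in>C. E b c" for a b
    proof -
      have ab: "a \<in> S" "b \<in> S" using that set_iff C_subset by blast+
      then obtain c where c: "c \<in> H" "\<forall>u\<in>M. E u c \<longleftrightarrow> E u a \<or> u = b"
        using ex_adj_set[of a b] S_subset by blast
      then have "c \<in> S" using adj_in_S[of a b c] ab H_subset by blast
      then have "c \<in> C" "\<exists>d\<in>C. E c d" using c(1) set_iff S_subset_C H_subset by blast+
      moreover have "\<forall>u\<in>C. E u c \<longleftrightarrow> E u a \<or> u = b" using c(2) C_subset by auto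
      ultimately show ?thesis by blast
    qed
    then show ?thesis by (simp add: TFS_Set_adj_def)
  qed
  moreover have "sat C E e \<phi>" if "\<phi> \<in> TFS_Ind"
  proof -
    obtain x y z \<psi> where \<phi>: "\<phi> = rel is_set (closure (ind x y z \<psi>))"
      and d: "distinct [x, y, z]" "y \<notin> fv \<psi>" "z \<notin> fv \<psi>"
      using \<open>\<phi> \<in> TFS_Ind\<close> unfolding TFS_Ind_def by blast
    \<comment> \<open>\<open>sat_rel\<close> is used with domain \<open>C\<close>, relativizing
      class \<open>S\<close>, and environments with values in all of \<open>M\<close>.\<close>
    have "sat C E e \<phi> \<longleftrightarrow> sat S E e (closure (ind x y z \<psi>))"
      unfolding \<phi> using assms(2) S_subset_C C_subset
      by (intro sat_rel[of M]) (simp_all only: sat_C_is_set)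
    then show ?thesis using S.induction[OF d] by (simp add: sat_closure[OF S.N_nonempty])
  qed
  ultimately show ?thesis using assms(1) sat_C_Class by (auto simp: TFS_def)
qed

end

theorem theorem1:
  fixes M :: "'a set" and E :: "'a \<Rightarrow> 'a \<Rightarrow> bool"
  assumes "models M E TFS"
  shows "models M E (rel is_std_class ` TFS)
    \<and> models M E (rel is_set ` ZF_fin)
    \<and> models M E (rel is_std ` ZF_fin)"
proof -
  interpret TFS_model M E using assms by unfold_locales
  \<comment> \<open>Truth in \<open>M\<close> of axioms relativized to \<open>is_std_class\<close>,
    \<open>is_set\<close> and \<open>is_std\<close> is truth in \<open>C\<close>, \<open>H\<close>
    and \<open>S\<close> under the same environment, whose values may be any classes in
    \<open>M\<close>.\<close>
  show ?thesis
    using M_nonempty sat_C_TFS H.sat_ZF_fin S.sat_ZF_fin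
    by (auto simp: models_def sat_rel_is_std_class sat_rel_is_set sat_rel_is_std)
qed

end
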